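(* Let $p,q\geq 0$ be integers and let ${\bf c}=1^p\,2\,1^q$ be the color vector consisting of $p$ entries equal to $1$, then one entry equal to $2$, then $q$ entries equal to $1$. Then the color graph associated to ${\bf c}$ is isomorphic to the subgraph of the integer lattice graph $L(p)$ induced by the vertex set $$\{(x_1,\dots,x_p)\in\mathbb{Z}^p : 0\leq x_1\leq x_2\leq\cdots\leq x_p\leq q\}.$$
   Context: Let $V=\mathbb{Z}_2\times\mathbb{Z}_2$ be the Klein four-group, with elements written $0,1,2,3$, so that $1+2+3=0$ and $x+x=0$ for all $x$. A binary tree with $k$ leaves is a rooted planar binary tree: the root has degree $1$, every internal vertex has degree $3$, and the $k$ leaves are ordered from left to right. A color vector of length $k$ is a sequence ${\bf c}=(c_1,\dots,c_k)$ of nonzero elements of $V$. The color vector ${\bf c}$ is valid for a binary tree $T$ with $k$ leaves if there is a coloring of the edges of $T$ by $\{1,2,3\}$ in which the edge at the $i$-th leaf (counted from the left) has color $c_i$ for every $i$, and at each internal vertex the colors of the three incident edges sum to $0$ in $V$. The vertices of the color graph of ${\bf c}$ are the binary trees with $k$ leaves for which ${\bf c}$ is valid; two such trees are joined by an edge iff they differ by a single rotation (the standard local move $((A,B),C)\leftrightarrow(A,(B,C))$ on a subtree, equivalently a diagonal flip of the dual triangulation of a $(k+1)$-gon). The integer lattice graph $L(m)$ has vertex set $\mathbb{Z}^m$, two vectors being adjacent iff they differ in exactly one coordinate and there by $\pm1$. *)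

theory Defs
  imports
    "HOL-Library.Z2"
    "HOL-Library.Product_Plus"
    "Graph_Theory.Graph_Theory"
begin

type_synonym klein = "bit \<times> bit"

definition col1 :: klein where "col1 = (1, 0)"
definition col2 :: klein where "col2 = (0, 1)"
definition col3 :: klein where "col3 = (1, 1)"

lemma klein_UNIV: "(UNIV :: klein set) = {0, col1, col2, col3}"
proof -
  have "(a, b) \<in> {0, col1, col2, col3}" for a b :: bit
    by (cases a; cases b) (simp_all add: col1_def col2_def col3_def zero_prod_def)
  then show ?thesis by (metis UNIV_eq_I surj_pair)
qed

lemma klein_add: "x + x = (0 :: klein)" "col1 + col2 + col3 = 0"
  by (cases x) (simp_all add: col1_def col2_def col3_def zero_prod_def)

text \<open>
  The root of degree 1 is implicit: the one-leaf tree \<open>Leaf\<close> is a single edge joining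
  the root to the leaf, and the edge above the topmost internal vertex of \<open>Node l r\<close> goes
  to the root.
\<close>

datatype btree = Leaf | Node btree btree

text \<open>
  A vertex other than the root is addressed by the path leading to it from the topmost
  one (\<open>False\<close> is left, \<open>True\<close> is right). Every edge is identified with the address of its
  lower end.
\<close>

fun edges :: "btree \<Rightarrow> bool list set" where
  "edges Leaf = {[]}"
| "edges (Node l r) = {[]} \<union> Cons False ` edges l \<union> Cons True ` edges r"

fun inner :: "btree \<Rightarrow> bool list set" where
  "inner Leaf = {}"
| "inner (Node l r) = {[]} \<union> Cons False ` inner l \<union> Cons True ` inner r"

fun leaves :: "btree \<Rightarrow> bool list list" where
  "leaves Leaf = [[]]"
| "leaves (Node l r) = map (Cons False) (leaves l) @ map (Cons True) (leaves r)"

definition proper_coloring :: "btree \<Rightarrow> (bool list \<Rightarrow> klein) \<Rightarrow> bool" where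
  "proper_coloring t \<chi> \<longleftrightarrow>
     (\<forall>e \<in> edges t. \<chi> e \<in> {col1, col2, col3}) \<and>
     (\<forall>v \<in> inner t. \<chi> v + \<chi> (v @ [False]) + \<chi> (v @ [True]) = 0)"

definition valid :: "klein list \<Rightarrow> btree \<Rightarrow> bool" where
  "valid c t \<longleftrightarrow> length (leaves t) = length c \<and>
     (\<exists>\<chi>. proper_coloring t \<chi> \<and> (\<forall>i < length c. \<chi> (leaves t ! i) = c ! i))"

inductive rotate_right :: "btree \<Rightarrow> btree \<Rightarrow> bool" where
  top: "rotate_right (Node (Node a b) c) (Node a (Node b c))"
| left: "rotate_right l l' \<Longrightarrow> rotate_right (Node l r) (Node l' r)"
| right: "rotate_right r r' \<Longrightarrow> rotate_right (Node l r) (Node l r')"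

definition rotation :: "btree \<Rightarrow> btree \<Rightarrow> bool" where
  "rotation s t \<longleftrightarrow> rotate_right s t \<or> rotate_right t s"

text \<open>
  As usual in \<open>Graph_Theory\<close>, an undirected simple graph is a symmetric loop-free digraph
  without parallel arcs.
\<close>

definition color_graph :: "klein list \<Rightarrow> btree pair_pre_digraph" where
  "color_graph c =
     \<lparr> pverts = {t. valid c t},
       parcs = {(s, t). valid c s \<and> valid c t \<and> rotation s t} \<rparr>"

definition lattice_adj :: "nat \<Rightarrow> int list \<Rightarrow> int list \<Rightarrow> bool" where
  "lattice_adj m x y \<longleftrightarrow>
     (\<exists>i < m. \<bar>x ! i - y ! i\<bar> = 1 \<and> (\<forall>j < m. j \<noteq> i \<longrightarrow> x ! j = y ! j))"

definition lattice_graph :: "nat \<Rightarrow> int list pair_pre_digraph" where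
  "lattice_graph m =
     \<lparr> pverts = {x. length x = m},
       parcs = {(x, y). length x = m \<and> length y = m \<and> lattice_adj m x y} \<rparr>"

lemma rotate_right_neq: "rotate_right s t \<Longrightarrow> s \<noteq> t"
proof (induction rule: rotate_right.induct)
  case (top a b c)
  have "size (Node a b) \<noteq> size a" by simp
  then show ?case by (metis btree.inject)
qed simp_all

lemma color_graph_simple: "pair_bidirected_digraph (color_graph c)"
proof
  show "symmetric (with_proj (color_graph c))"
    unfolding symmetric_def by (rule symI) (auto simp: color_graph_def rotation_def)
next
  fix e assume "e \<in> parcs (color_graph c)"
  then have "rotation (fst e) (snd e)" by (auto simp: color_graph_def)
  then show "fst e \<noteq> snd e" unfolding rotation_def using rotate_right_neq by metis
qed (auto simp: color_graph_def)

lemma lattice_adj_sym: "lattice_adj m x y \<Longrightarrow> lattice_adj m y x"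
  unfolding lattice_adj_def by (metis abs_minus_commute)

lemma lattice_graph_simple: "pair_bidirected_digraph (lattice_graph m)"
proof
  show "symmetric (with_proj (lattice_graph m))"
    unfolding symmetric_def by (rule symI) (auto simp: lattice_graph_def lattice_adj_sym)
next
  fix e assume "e \<in> parcs (lattice_graph m)"
  then have "lattice_adj m (fst e) (snd e)" by (auto simp: lattice_graph_def)
  then show "fst e \<noteq> snd e" by (auto simp: lattice_adj_def)
qed (auto simp: lattice_graph_def)

end

theory Submission
  imports Defs
begin

text \<open>
  A subtree all of whose leaves have color 1 must be a single leaf, because a cherry of two such
  leaves would give its upper edge the color 0. Hence a tree is valid for \<open>1\<^sup>p 2 1\<^sup>q\<close> iff it is a
  caterpillar: along the path from the root to the leaf of color 2 one passes \<open>p\<close> left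
  and \<open>q\<close> right sibling leaves, in an arbitrary order. Let \<open>x\<^sub>i\<close> be the number of right leaves
  passed before the \<open>i\<close>-th left leaf. A rotation between two such trees swaps two
  consecutive sibling leaves lying on different sides, which changes exactly one \<open>x\<^sub>i\<close> by one.
\<close>

section \<open>Validity in terms of subtrees\<close>

lemma mem_colors_iff: "x \<in> {col1, col2, col3} \<longleftrightarrow> x \<noteq> (0 :: klein)"
proof -
  have "0 \<notin> {col1, col2, col3}"
    by (simp add: col1_def col2_def col3_def zero_prod_def)
  moreover have "x \<in> {0, col1, col2, col3}"
    using klein_UNIV by blast
  ultimately show ?thesis
    by auto
qed

lemma klein_add_eq_0_iff: "x + y = 0 \<longleftrightarrow> x = (y :: klein)"
  by (metis add.assoc add_0 add.right_neutral klein_add(1))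

lemma proper_coloring_Leaf: "proper_coloring Leaf \<chi> \<longleftrightarrow> \<chi> [] \<noteq> 0"
  unfolding proper_coloring_def mem_colors_iff by simp

lemma proper_coloring_Node:
  "proper_coloring (Node l r) \<chi> \<longleftrightarrow>
     \<chi> [] \<noteq> 0 \<and> \<chi> [] = \<chi> [False] + \<chi> [True] \<and>
     proper_coloring l (\<lambda>v. \<chi> (False # v)) \<and> proper_coloring r (\<lambda>v. \<chi> (True # v))"
  unfolding proper_coloring_def mem_colors_iff
  by (auto simp: ball_Un add.assoc klein_add_eq_0_iff)

text \<open>Since \<open>x + x = 0\<close>, the vertex condition says that an upper edge carries the
  sum of the two edges below it; by induction the leaf colors force the color of the root
  edge.\<close>

lemma proper_coloring_root:
  "proper_coloring t \<chi> \<Longrightarrow> \<chi> [] = sum_list (map \<chi> (leaves t))"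
  by (induction t arbitrary: \<chi>) (auto simp: proper_coloring_Node comp_def)

lemma valid_iff: "valid c t \<longleftrightarrow> (\<exists>\<chi>. proper_coloring t \<chi> \<and> map \<chi> (leaves t) = c)"
  unfolding valid_def by (auto simp: list_eq_iff_nth_eq)

lemma valid_Leaf: "valid c Leaf \<longleftrightarrow> (\<exists>x. x \<noteq> 0 \<and> c = [x])"
proof
  assume "valid c Leaf"
  then show "\<exists>x. x \<noteq> 0 \<and> c = [x]"
    unfolding valid_iff proper_coloring_Leaf leaves.simps list.map by blast
next
  assume "\<exists>x. x \<noteq> 0 \<and> c = [x]"
  then obtain x where "x \<noteq> 0" "c = [x]"
    by blast
  then show "valid c Leaf"
    unfolding valid_iff proper_coloring_Leaf by (intro exI[of _ "\<lambda>_. x"]) simp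
qed

text \<open>Once both children are colored, the condition at the top vertex fixes the color of the
  root edge as the sum of all leaf colors, so the only obstruction is that this sum is 0. Colorings
  thus disappear from the later arguments.\<close>

lemma valid_Node:
  "valid c (Node l r) \<longleftrightarrow>
     sum_list c \<noteq> 0 \<and> (\<exists>c1 c2. c = c1 @ c2 \<and> valid c1 l \<and> valid c2 r)"
proof
  assume "valid c (Node l r)"
  then obtain \<chi> where \<chi>: "proper_coloring (Node l r) \<chi>" "map \<chi> (leaves (Node l r)) = c"
    unfolding valid_iff by blast
  then have "sum_list c \<noteq> 0"
    using proper_coloring_root proper_coloring_Node by metis
  moreover have "valid (map (\<lambda>v. \<chi> (False # v)) (leaves l)) l"
    "valid (map (\<lambda>v. \<chi> (True # v)) (leaves r)) r"
    using \<chi>(1) unfolding valid_iff proper_coloring_Node by blast+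
  ultimately show "sum_list c \<noteq> 0 \<and> (\<exists>c1 c2. c = c1 @ c2 \<and> valid c1 l \<and> valid c2 r)"
    using \<chi>(2) by (auto simp: comp_def)
next
  assume "sum_list c \<noteq> 0 \<and> (\<exists>c1 c2. c = c1 @ c2 \<and> valid c1 l \<and> valid c2 r)"
  then obtain \<alpha> \<beta> where
    nz: "sum_list c \<noteq> 0" and
    c: "c = map \<alpha> (leaves l) @ map \<beta> (leaves r)" and
    proper: "proper_coloring l \<alpha>" "proper_coloring r \<beta>"
    unfolding valid_iff by blast
  \<comment> \<open>The two colorings are glued along the first letter of the path; the root edge
    gets the one color that \<open>proper_coloring_root\<close> allows.\<close>
  define \<chi> where
    "\<chi> v = (case v of [] \<Rightarrow> sum_list c | b # u \<Rightarrow> if b then \<beta> u else \<alpha> u)" for v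
  have "proper_coloring (Node l r) \<chi>"
    unfolding proper_coloring_Node \<chi>_def
    using nz c proper proper_coloring_root[OF proper(1)] proper_coloring_root[OF proper(2)]
    by simp
  moreover have "map \<chi> (leaves (Node l r)) = c"
    by (simp add: c \<chi>_def)
  ultimately show "valid c (Node l r)"
    unfolding valid_iff by blast
qed

section \<open>Valid trees as caterpillars\<close>

lemma replicate_eq_appendD:
  assumes "replicate n x = xs @ ys"
  shows "xs = replicate (length xs) x" "ys = replicate (length ys) x" "n = length xs + length ys"
proof -
  have "set (xs @ ys) \<subseteq> {x}"
    using assms by (metis set_replicate_conv_if empty_subsetI order_refl)
  then show "xs = replicate (length xs) x" "ys = replicate (length ys) x"
    by (auto intro!: replicate_length_same[symmetric])
  show "n = length xs + length ys"
    using assms by (metis length_append length_replicate)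
qed

lemma valid_replicate_col1: "valid (replicate n col1) t \<Longrightarrow> t = Leaf \<and> n = 1"
proof (induction t arbitrary: n)
  case Leaf
  then show ?case
    by (auto simp: valid_Leaf dest: arg_cong[of _ _ length])
next
  case (Node l r)
  then obtain c1 c2 where c: "replicate n col1 = c1 @ c2" "valid c1 l" "valid c2 r"
    and nz: "sum_list (replicate n col1) \<noteq> 0"
    unfolding valid_Node by blast
  note split = replicate_eq_appendD[OF c(1)]
  have "length c1 = 1"
    using c(2) by (subst (asm) split(1)) (blast dest: Node.IH(1))
  moreover have "length c2 = 1"
    using c(3) by (subst (asm) split(2)) (blast dest: Node.IH(2))
  ultimately have "n = 2"
    using split(3) by simp
  then show ?case
    using nz by (simp add: numeral_2_eq_2 klein_add(1))
qed

text \<open>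
  A word lists the sibling leaves from the root downwards; \<open>True\<close> stands for a leaf on the left of
  the path, \<open>False\<close> for one on the right.
\<close>

fun caterpillar :: "bool list \<Rightarrow> btree" where
  "caterpillar [] = Leaf"
| "caterpillar (True # w) = Node Leaf (caterpillar w)"
| "caterpillar (False # w) = Node (caterpillar w) Leaf"

definition words :: "nat \<Rightarrow> nat \<Rightarrow> bool list set" where
  "words p q = {w. count_list w True = p \<and> count_list w False = q}"

lemma Nil_in_words: "[] \<in> words p q \<longleftrightarrow> p = 0 \<and> q = 0"
  by (auto simp: words_def)

lemma True_Cons_in_words: "True # w \<in> words p q \<longleftrightarrow> (\<exists>p'. p = Suc p' \<and> w \<in> words p' q)"
  by (auto simp: words_def)

lemma False_Cons_in_words: "False # w \<in> words p q \<longleftrightarrow> (\<exists>q'. q = Suc q' \<and> w \<in> words p q')"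
  by (auto simp: words_def)

lemmas in_words_simps = Nil_in_words True_Cons_in_words False_Cons_in_words

lemma caterpillar_eq_Leaf_iff: "caterpillar w = Leaf \<longleftrightarrow> w = []"
  by (cases w rule: caterpillar.cases) auto

text \<open>
  Injectivity needs fixed letter counts: the words \<open>[True]\<close> and \<open>[False]\<close> give the same tree.
\<close>

lemma inj_on_caterpillar: "inj_on caterpillar (words p q)"
proof (rule inj_onI)
  fix w w'
  assume "w \<in> words p q" "w' \<in> words p q" "caterpillar w = caterpillar w'"
  then show "w = w'"
  proof (induction w arbitrary: w' p q rule: caterpillar.induct)
    case 1
    then show ?case
      by (metis caterpillar_eq_Leaf_iff caterpillar.simps(1))
  next
    \<comment> \<open>If the first letters differ, comparing children forces both tails to be empty,
      and then the letter counts of the two words disagree.\<close>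
    case (2 w)
    then show ?case
      by (cases w' rule: caterpillar.cases) (auto simp: in_words_simps caterpillar_eq_Leaf_iff)
  next
    case (3 w)
    then show ?case
      by (cases w' rule: caterpillar.cases)
        (auto simp: in_words_simps caterpillar_eq_Leaf_iff dest!: sym[of Leaf])
  qed
qed

abbreviation one_two_colors :: "nat \<Rightarrow> nat \<Rightarrow> klein list" where
  "one_two_colors p q \<equiv> replicate p col1 @ [col2] @ replicate q col1"

text \<open>The second component of a sum is the parity of the number of 2s, as \<open>col1\<close>
  contributes 0 to it; here it is 1.\<close>

lemma sum_list_one_two_colors: "sum_list (one_two_colors p q) \<noteq> 0"
proof -
  have "snd (sum_list (replicate n col1)) = 0" for n
    by (induction n) (auto simp: col1_def)
  then have "snd (sum_list (one_two_colors p q)) = 1"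
    by (simp add: col2_def)
  then show ?thesis
    by (metis snd_zero zero_neq_one)
qed

lemma valid_caterpillar: "w \<in> words p q \<Longrightarrow> valid (one_two_colors p q) (caterpillar w)"
proof (induction w arbitrary: p q rule: caterpillar.induct)
  case 1
  then show ?case
    by (simp add: in_words_simps valid_Leaf col2_def zero_prod_def)
next
  have leaf: "valid [col1] Leaf"
    by (simp add: valid_Leaf col1_def zero_prod_def)
  {
    case (2 w)
    then obtain p' where p: "p = Suc p'" and "w \<in> words p' q"
      by (auto simp: in_words_simps)
    then have "valid (one_two_colors p' q) (caterpillar w)"
      using 2 by blast
    moreover have "one_two_colors p q = [col1] @ one_two_colors p' q"
      by (simp add: p)
    ultimately show ?case
      using leaf sum_list_one_two_colors unfolding caterpillar.simps valid_Node by blast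
  next
    case (3 w)
    then obtain q' where q: "q = Suc q'" and "w \<in> words p q'"
      by (auto simp: in_words_simps)
    then have "valid (one_two_colors p q') (caterpillar w)"
      using 3 by blast
    moreover have "one_two_colors p q = one_two_colors p q' @ [col1]"
      by (simp add: q replicate_append_same)
    ultimately show ?case
      using leaf sum_list_one_two_colors unfolding caterpillar.simps valid_Node by blast
  }
qed

text \<open>The single 2 lies in one of the two pieces, so the other piece consists of 1s only. With
  \<open>valid_replicate_col1\<close> this forces one child of the top vertex to be a leaf.\<close>

lemma append_eq_one_two_colors:
  assumes "one_two_colors p q = c1 @ c2"
  shows "(\<exists>q1 q2. c1 = one_two_colors p q1 \<and> c2 = replicate q2 col1 \<and> q = q1 + q2) \<or>
    (\<exists>p1 p2. c1 = replicate p1 col1 \<and> c2 = one_two_colors p2 q \<and> p = p1 + p2)"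
  using assms
proof (induction p arbitrary: c1)
  case 0
  show ?case
  proof (cases c1)
    case Nil
    then show ?thesis
      using 0 by (intro disjI2 exI[of _ 0]) simp
  next
    case (Cons a d)
    then have "a = col2" "replicate q col1 = d @ c2"
      using 0 by auto
    with replicate_eq_appendD[OF this(2)] Cons show ?thesis
      by (intro disjI1 exI[of _ "length d"] exI[of _ "length c2"]) simp
  qed
next
  case (Suc p)
  show ?case
  proof (cases c1)
    case Nil
    then show ?thesis
      using Suc.prems by (intro disjI2 exI[of _ 0] exI[of _ "Suc p"]) simp
  next
    case (Cons a d)
    then have "a = col1" "one_two_colors p q = d @ c2"
      using Suc.prems by auto
    with Suc.IH[OF this(2)] Cons show ?thesis
      by (metis replicate_Suc append_Cons add_Suc)
  qed
qed

text \<open>The word is read off from the root downwards: the child without the color 2 is a leaf,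
  its side gives the first letter, and induction handles the other child.\<close>

lemma valid_one_two_colorsE:
  assumes "valid (one_two_colors p q) t"
  obtains w where "w \<in> words p q" "t = caterpillar w"
proof -
  have "\<exists>w \<in> words p q. t = caterpillar w"
    using assms
  proof (induction t arbitrary: p q)
    case Leaf
    then have "p + 1 + q = 1"
      by (auto simp: valid_Leaf dest: arg_cong[of _ _ length])
    then show ?case
      by (intro bexI[of _ "[]"]) (auto simp: in_words_simps)
  next
    case (Node l r)
    then obtain c1 c2 where c: "one_two_colors p q = c1 @ c2" and l: "valid c1 l" and r: "valid c2 r"
      unfolding valid_Node by blast
    from append_eq_one_two_colors[OF c] show ?case
    proof (elim disjE exE conjE)
      fix q1 q2
      assume c1: "c1 = one_two_colors p q1" and c2: "c2 = replicate q2 col1" and q: "q = q1 + q2"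
      have "r = Leaf" "q2 = 1"
        using valid_replicate_col1 r c2 by blast+
      moreover obtain w where "w \<in> words p q1" "l = caterpillar w"
        using Node.IH(1) l c1 by blast
      ultimately show ?case
        using q by (intro bexI[of _ "False # w"]) (auto simp: in_words_simps)
    next
      fix p1 p2
      assume c1: "c1 = replicate p1 col1" and c2: "c2 = one_two_colors p2 q" and p: "p = p1 + p2"
      have "l = Leaf" "p1 = 1"
        using valid_replicate_col1 l c1 by blast+
      moreover obtain w where "w \<in> words p2 q" "r = caterpillar w"
        using Node.IH(2) r c2 by blast
      ultimately show ?case
        using p by (intro bexI[of _ "True # w"]) (auto simp: in_words_simps)
    qed
  qed
  then show thesis
    using that by blast
qed

lemma bij_betw_caterpillar:
  "bij_betw caterpillar (words p q) {t. valid (one_two_colors p q) t}"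
  unfolding bij_betw_def using inj_on_caterpillar valid_caterpillar
  by (blast elim: valid_one_two_colorsE)

section \<open>Rotations as adjacent swaps\<close>

text \<open>Oriented to match \<open>rotate_right\<close>: rotating
  \<open>Node (Node Leaf t) Leaf\<close> into \<open>Node Leaf (Node t Leaf)\<close> moves a left
  sibling leaf above a right one.\<close>

inductive swap :: "bool list \<Rightarrow> bool list \<Rightarrow> bool" where
  here: "swap (False # True # w) (True # False # w)"
| there: "swap w w' \<Longrightarrow> swap (a # w) (a # w')"

lemma swap_imp_rotate_right: "swap w w' \<Longrightarrow> rotate_right (caterpillar w) (caterpillar w')"
proof (induction rule: swap.induct)
  case (there w w' a)
  then show ?case
    by (cases a) (auto intro: rotate_right.intros)
qed (auto intro: rotate_right.intros)

lemma not_rotate_right_Leaf: "\<not> rotate_right Leaf t" "\<not> rotate_right t Leaf"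
  by (auto elim: rotate_right.cases)

lemma rotate_right_imp_swap:
  assumes "rotate_right (caterpillar w) (caterpillar w')" "w \<in> words p q" "w' \<in> words p q"
  shows "swap w w'"
  using assms
proof (induction w arbitrary: w' p q rule: caterpillar.induct)
  case 1
  then show ?case
    by (simp add: not_rotate_right_Leaf)
next
  case (2 w)
  \<comment> \<open>A right rotation at the top needs an inner vertex as left child, but that child
    is a leaf; so the rotation takes place inside the right child.\<close>
  from 2(2) have "\<exists>r. rotate_right (caterpillar w) r \<and> caterpillar w' = Node Leaf r"
    by (auto elim: rotate_right.cases simp: not_rotate_right_Leaf)
  then obtain r where r: "rotate_right (caterpillar w) r" "caterpillar w' = Node Leaf r"
    by blast
  \<comment> \<open>This excludes that \<open>w'\<close> starts with \<open>False\<close>, which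
    would make the right child a leaf.\<close>
  moreover from r have "r \<noteq> Leaf"
    using not_rotate_right_Leaf by blast
  ultimately obtain v where "w' = True # v" "r = caterpillar v"
    by (cases w' rule: caterpillar.cases) auto
  then show ?case
    using 2 r by (auto simp: in_words_simps intro: swap.there)
next
  case (3 w)
  from 3(2) show ?case
    unfolding caterpillar.simps
  proof cases
    case (top a b)
    note w = top(1) and w' = top(2)
    \<comment> \<open>The rotated tree is \<open>Node a (Node b Leaf)\<close>; its right child is
      not a leaf, so \<open>w'\<close> must start with \<open>True\<close>.\<close>
    obtain v where v: "w' = True # v" "a = Leaf" "caterpillar v = Node b Leaf"
      using w' by (cases w' rule: caterpillar.cases) auto
    show ?thesis
    proof (cases w rule: caterpillar.cases)
      case 1
      then show ?thesis
        using w by simp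
    next
      case (2 u)
      then have "caterpillar v = caterpillar (False # u)"
        using v w by simp
      moreover have "v \<in> words (p - 1) q" "False # u \<in> words (p - 1) q"
        using 3(3,4) 2 v(1) by (auto simp: in_words_simps)
      ultimately have "v = False # u"
        by (rule inj_onD[OF inj_on_caterpillar])
      then show ?thesis
        using 2 v(1) by (simp add: swap.here)
    next
      \<comment> \<open>Here the trees are the two trees with three leaves, obtained from
        \<open>[False, False]\<close> and a word starting with \<open>True\<close>. They do differ
        by a rotation, but the words have different letter counts.\<close>
      case (3 u)
      then have "caterpillar u = Leaf" "b = Leaf"
        using w v by auto
      then have "w = [False]"
        using 3 by (simp add: caterpillar_eq_Leaf_iff)
      then show ?thesis
        using \<open>False # w \<in> words p q\<close> \<open>w' \<in> words p q\<close> v(1) by (auto simp: in_words_simps)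
    qed
  next
    case (left l')
    then obtain v where "w' = False # v" "l' = caterpillar v"
      by (cases w' rule: caterpillar.cases) (auto simp: not_rotate_right_Leaf)
    then show ?thesis
      using 3 left by (auto simp: in_words_simps intro: swap.there)
  next
    case (right r')
    then show ?thesis
      by (simp add: not_rotate_right_Leaf)
  qed
qed

lemma rotation_caterpillar_iff:
  assumes "w \<in> words p q" "w' \<in> words p q"
  shows "rotation (caterpillar w) (caterpillar w') \<longleftrightarrow> swap w w' \<or> swap w' w"
  unfolding rotation_def using assms rotate_right_imp_swap swap_imp_rotate_right by metis

section \<open>Lattice coordinates of a word\<close>

text \<open>The accumulator \<open>k\<close> is the number of right leaves passed so far. Seen as a
  lattice path, the word is recorded by the heights of its \<open>True\<close> steps.\<close>

fun coords :: "int \<Rightarrow> bool list \<Rightarrow> int list" where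
  "coords k [] = []"
| "coords k (True # w) = k # coords k w"
| "coords k (False # w) = coords (k + 1) w"

lemma coords_ge: "x \<in> set (coords k w) \<Longrightarrow> k \<le> x"
  by (induction k w rule: coords.induct) force+

lemma coords_le: "x \<in> set (coords k w) \<Longrightarrow> x \<le> k + int (count_list w False)"
  by (induction k w rule: coords.induct) force+

lemma sorted_coords: "sorted (coords k w)"
  by (induction k w rule: coords.induct) (auto intro: coords_ge)

lemma length_coords: "length (coords k w) = count_list w True"
  by (induction k w rule: coords.induct) auto

text \<open>A word starting with \<open>True\<close> produces \<open>k\<close> at once, whereas
  after \<open>False\<close> all entries exceed \<open>k\<close>, so the first letter can be
  recovered. Trailing \<open>False\<close> letters leave no trace and are recovered from the fixed
  count \<open>q\<close>.\<close>

lemma inj_on_coords: "inj_on (coords k) (words p q)"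
proof (rule inj_onI)
  fix w w'
  assume "w \<in> words p q" "w' \<in> words p q" "coords k w = coords k w'"
  then show "w = w'"
  proof (induction k w arbitrary: w' p q rule: coords.induct)
    case (1 k)
    then show ?case
      by (cases w' rule: caterpillar.cases) (auto simp: in_words_simps)
  next
    case (2 k w)
    have "k \<notin> set (coords (k + 1) v)" for v
      using coords_ge by force
    with 2 show ?case
      by (cases w' rule: caterpillar.cases) (auto simp: in_words_simps, metis list.set_intros(1))
  next
    case (3 k w)
    have "k \<notin> set (coords (k + 1) v)" for v
      using coords_ge by force
    with 3 show ?case
      by (cases w' rule: caterpillar.cases) (auto simp: in_words_simps, metis list.set_intros(1))
  qed
qed

text \<open>The word is built greedily: \<open>True\<close> while the next entry equals the counter
  \<open>k\<close>, otherwise \<open>False\<close>, which raises \<open>k\<close> and uses up one of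
  the \<open>q\<close> right leaves.\<close>

lemma coords_surj:
  "sorted (k # x @ [k + int q]) \<Longrightarrow> \<exists>w \<in> words (length x) q. coords k w = x"
proof (induction "length x + q" arbitrary: k x q)
  case 0
  then show ?case
    by (intro bexI[of _ "[]"]) (auto simp: in_words_simps)
next
  case (Suc n)
  show ?case
  proof (cases "x \<noteq> [] \<and> hd x = k")
    case True
    then obtain y where x: "x = k # y"
      by (cases x) auto
    then have "\<exists>w \<in> words (length y) q. coords k w = y"
      using Suc by (intro Suc.hyps) auto
    then obtain w where "w \<in> words (length y) q" "coords k w = y" by blast
    then show ?thesis
      using x by (intro bexI[of _ "True # w"]) (auto simp: in_words_simps)
  next
    case False
    \<comment> \<open>For \<open>q = 0\<close> the entries are squeezed to \<open>k\<close>, so a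
      nonempty \<open>x\<close> would start with \<open>k\<close>, while an empty one contradicts
      \<open>length x + q = Suc n\<close>.\<close>
    have "q \<noteq> 0"
    proof
      assume "q = 0"
      then show False
        using Suc.prems Suc.hyps(2) False by (cases x) auto
    qed
    then obtain q' where q: "q = Suc q'"
      by (cases q) auto
    have "\<forall>z \<in> set x. k + 1 \<le> z"
      using Suc.prems False by (cases x) fastforce+
    then have "\<exists>w \<in> words (length x) q'. coords (k + 1) w = x"
      using Suc q by (intro Suc.hyps) (auto simp: algebra_simps)
    then obtain w where "w \<in> words (length x) q'" "coords (k + 1) w = x" by blast
    then show ?thesis
      using q by (intro bexI[of _ "False # w"]) (auto simp: in_words_simps)
  qed
qed

lemma bij_betw_coords:
  "bij_betw (coords 0) (words p q) {x. length x = p \<and> sorted ([0] @ x @ [int q])}"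
proof -
  have "coords 0 w \<in> {x. length x = p \<and> sorted ([0] @ x @ [int q])}" if "w \<in> words p q" for w
    using that coords_ge coords_le sorted_coords
    by (fastforce simp: words_def length_coords sorted_append)
  moreover have "x \<in> coords 0 ` words p q" if "length x = p" "sorted ([0] @ x @ [int q])" for x
    using coords_surj[of 0 x q] that by auto
  ultimately show ?thesis
    unfolding bij_betw_def using inj_on_coords by blast
qed

text \<open>An oriented half of lattice adjacency, given recursively so that it can be compared with
  \<open>swap\<close> letter by letter.\<close>

inductive lowers :: "int list \<Rightarrow> int list \<Rightarrow> bool" where
  here: "lowers ((z + 1) # x) (z # x)"
| there: "lowers x y \<Longrightarrow> lowers (z # x) (z # y)"

inductive_cases lowers_ConsE: "lowers (a # x) (b # y)"

lemma lowers_nth: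
  "lowers x y \<Longrightarrow>
     \<exists>i < length x. x ! i = y ! i + 1 \<and> (\<forall>j < length x. j \<noteq> i \<longrightarrow> x ! j = y ! j)"
proof (induction rule: lowers.induct)
  case (here z x)
  then show ?case
    by (intro exI[of _ 0]) (auto simp: nth_Cons')
next
  case (there x y z)
  then obtain i where "i < length x" "x ! i = y ! i + 1" "\<forall>j < length x. j \<noteq> i \<longrightarrow> x ! j = y ! j"
    by blast
  then show ?case
    by (intro exI[of _ "Suc i"]) (auto simp: nth_Cons')
qed

lemma lowersI_nth:
  assumes "length x = length y" "i < length x" "x ! i = y ! i + 1"
    "\<forall>j < length x. j \<noteq> i \<longrightarrow> x ! j = y ! j"
  shows "lowers x y"
  using assms
proof (induction x y arbitrary: i rule: list_induct2)
  case (Cons a x b y)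
  show ?case
  proof (cases i)
    case 0
    then have "a = b + 1" "x = y"
      using Cons by (fastforce intro: nth_equalityI)+
    then show ?thesis
      by (simp add: lowers.here)
  next
    case (Suc i')
    then have "a = b"
      using Cons.prems(3) by force
    moreover have "x ! j = y ! j" if "j < length x" "j \<noteq> i'" for j
      using Cons.prems(3) Suc that by (metis Suc_less_eq length_Cons nat.inject nth_Cons_Suc)
    then have "lowers x y"
      using Cons Suc by (intro Cons.IH[of i']) auto
    ultimately show ?thesis
      by (simp add: lowers.there)
  qed
qed simp

lemma lattice_adj_iff_lowers:
  assumes "length x = m" "length y = m"
  shows "lattice_adj m x y \<longleftrightarrow> lowers x y \<or> lowers y x"
proof
  assume "lattice_adj m x y"
  then obtain i where i: "i < m" "\<bar>x ! i - y ! i\<bar> = 1" "\<forall>j < m. j \<noteq> i \<longrightarrow> x ! j = y ! j"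
    unfolding lattice_adj_def by blast
  then consider "x ! i = y ! i + 1" | "y ! i = x ! i + 1"
    by linarith
  then show "lowers x y \<or> lowers y x"
    using assms i lowersI_nth by cases metis+
next
  assume "lowers x y \<or> lowers y x"
  then show "lattice_adj m x y"
  proof
    assume "lowers x y"
    from lowers_nth[OF this] show ?thesis
      unfolding lattice_adj_def using assms by force
  next
    assume "lowers y x"
    from lowers_nth[OF this] show ?thesis
      unfolding lattice_adj_def using assms by force
  qed
qed

text \<open>The left leaf that moves up passes one right leaf, so its entry drops by one; behind the
  swapped pair the counter is the same in both words.\<close>

lemma swap_imp_lowers: "swap w w' \<Longrightarrow> lowers (coords k w) (coords k w')"
proof (induction arbitrary: k rule: swap.induct)
  case (there w w' a)
  then show ?case
    by (cases a) (auto intro: lowers.intros)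
qed (auto intro: lowers.intros)

lemma lowers_imp_swap:
  assumes "lowers (coords k w) (coords k w')" "w \<in> words p q" "w' \<in> words p q"
  shows "swap w w'"
  using assms
proof (induction k w arbitrary: w' p q rule: coords.induct)
  case (1 k)
  then show ?case
    by (auto elim: lowers.cases)
next
  case (2 k w)
  show ?case
  proof (cases w' rule: caterpillar.cases)
    case 1
    then show ?thesis
      using 2 by (simp add: in_words_simps)
  next
    case (2 v)
    then have "lowers (coords k w) (coords k v)"
      using \<open>lowers (coords k (True # w)) (coords k w')\<close> by (auto elim: lowers_ConsE)
    then show ?thesis
      using 2 "2.IH" "2.prems" by (auto simp: in_words_simps intro: swap.there)
  next
    \<comment> \<open>The first entry is \<open>k\<close> before lowering and can only stay or drop,
      but a word starting with \<open>False\<close> has all entries at least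
      \<open>k + 1\<close>.\<close>
    case (3 v)
    then obtain b y where "coords (k + 1) v = b # y" "b \<le> k"
      using \<open>lowers (coords k (True # w)) (coords k w')\<close> by (auto elim: lowers.cases)
    then show ?thesis
      using coords_ge[of b "k + 1" v] by simp
  qed
next
  case (3 k w)
  show ?case
  proof (cases w' rule: caterpillar.cases)
    case 1
    then show ?thesis
      using 3 by (simp add: in_words_simps)
  next
    case (2 v)
    then have low: "lowers (coords (k + 1) w) (k # coords k v)"
      using 3 by simp
    then obtain a y where y: "coords (k + 1) w = a # y"
      by (auto elim: lowers.cases)
    \<comment> \<open>The first entry is at least \<open>k + 1\<close> and becomes \<open>k\<close>,
      so it is the coordinate being lowered and the remaining entries agree.\<close>
    then have "a \<ge> k + 1"
      using coords_ge[of a "k + 1" w] by simp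
    then have "a = k + 1" "y = coords k v"
      using low unfolding y by (auto elim: lowers_ConsE)
    \<comment> \<open>A second \<open>False\<close> would push the first entry up to at least
      \<open>k + 2\<close>.\<close>
    have "\<exists>u. w = True # u \<and> coords (k + 1) u = y"
    proof (cases w rule: caterpillar.cases)
      case (3 u)
      then show ?thesis
        using y \<open>a = k + 1\<close> coords_ge[of a "k + 2" u] by (simp add: add.assoc)
    qed (use y in auto)
    then obtain u where u: "w = True # u" "coords (k + 1) u = y"
      by blast
    have "coords k v = coords k (False # u)"
      using u \<open>y = coords k v\<close> by simp
    moreover have "v \<in> words (p - 1) q" "False # u \<in> words (p - 1) q"
      using 3 2 u by (auto simp: in_words_simps)
    ultimately have "v = False # u"
      by (rule inj_onD[OF inj_on_coords])
    then show ?thesis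
      using 2 u by (simp add: swap.here)
  next
    case (3 v)
    then show ?thesis
      using "3.IH" "3.prems" by (auto simp: in_words_simps intro: swap.there)
  qed
qed

lemma lattice_adj_coords_iff:
  assumes "w \<in> words p q" "w' \<in> words p q"
  shows "lattice_adj p (coords 0 w) (coords 0 w') \<longleftrightarrow> swap w w' \<or> swap w' w"
proof -
  have "length (coords 0 w) = p" "length (coords 0 w') = p"
    using assms by (auto simp: length_coords words_def)
  then show ?thesis
    using lattice_adj_iff_lowers lowers_imp_swap swap_imp_lowers assms by metis
qed

section \<open>The isomorphism\<close>

text \<open>Arcs are pairs of vertices here, so a vertex bijection that preserves and reflects arcs
  determines the arc map \<open>map_prod f f\<close> and with it the whole isomorphism.\<close>

lemma digraph_iso_induce_subgraphI:
  assumes wf: "pair_wf_digraph G"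
    and bij: "bij_betw f (pverts G) S"
    and arcs: "\<And>u v. u \<in> pverts G \<Longrightarrow> v \<in> pverts G \<Longrightarrow>
      (u, v) \<in> parcs G \<longleftrightarrow> (f u, f v) \<in> parcs H"
  shows "digraph_iso (with_proj G) (with_proj H \<restriction> S)"
proof -
  interpret pair_wf_digraph G by (fact wf)
  define h where
    "h = \<lparr>iso_verts = f, iso_arcs = map_prod f f, iso_head = snd, iso_tail = fst\<rparr>"
  have sub: "parcs G \<subseteq> pverts G \<times> pverts G"
    using in_arcsD1 in_arcsD2 by auto
  have inj: "inj_on f (pverts G)" and img: "f ` pverts G = S"
    using bij by (auto simp: bij_betw_def)
  have "inj_on (map_prod f f) (parcs G)"
    using map_prod_inj_on[OF inj inj] sub inj_on_subset by blast
  then have "pre_digraph.digraph_isomorphism (with_proj G) h"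
    unfolding pre_digraph.digraph_isomorphism_def h_def
    using inj wf_digraph_axioms by auto
  moreover have "{e \<in> parcs H. fst e \<in> S \<and> snd e \<in> S} = map_prod f f ` parcs G"
  proof (intro equalityI subsetI)
    fix e
    assume "e \<in> {e \<in> parcs H. fst e \<in> S \<and> snd e \<in> S}"
    then obtain u v where "u \<in> pverts G" "v \<in> pverts G" "e = (f u, f v)" "e \<in> parcs H"
      using img by (cases e) auto
    then show "e \<in> map_prod f f ` parcs G"
      using arcs by force
  next
    fix e
    assume "e \<in> map_prod f f ` parcs G"
    then obtain u v where "(u, v) \<in> parcs G" "e = (f u, f v)"
      by auto
    then show "e \<in> {e \<in> parcs H. fst e \<in> S \<and> snd e \<in> S}"
      using arcs sub img by auto
  qed
  then have "with_proj H \<restriction> S = app_iso h (with_proj G)"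
    unfolding app_iso_def induce_subgraph_def h_def using img by simp
  ultimately show ?thesis
    unfolding digraph_iso_def by blast
qed

theorem theorem1:
  fixes p q :: nat
  shows "digraph_iso
           (with_proj (color_graph (replicate p col1 @ [col2] @ replicate q col1)))
           (with_proj (lattice_graph p) \<restriction>
              {x. length x = p \<and> sorted ([0] @ x @ [int q])})"
proof (rule digraph_iso_induce_subgraphI)
  let ?G = "color_graph (one_two_colors p q)"
  \<comment> \<open>The isomorphism sends a tree to its word and the word to its coordinates; both
    kinds of adjacency are compared through \<open>swap\<close> on words.\<close>
  define word where "word = the_inv_into (words p q) caterpillar"
  have verts: "pverts ?G = {t. valid (one_two_colors p q) t}"
    by (simp add: color_graph_def)
  have word: "bij_betw word (pverts ?G) (words p q)"
    unfolding word_def verts by (rule bij_betw_the_inv_into[OF bij_betw_caterpillar])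
  have caterpillar_word: "caterpillar (word t) = t" if "t \<in> pverts ?G" for t
    using that bij_betw_caterpillar[of p q] unfolding word_def verts
    by (intro f_the_inv_into_f_bij_betw) auto
  show "pair_wf_digraph ?G"
    by unfold_locales (auto simp: color_graph_def)
  show "bij_betw (coords 0 \<circ> word) (pverts ?G) {x. length x = p \<and> sorted ([0] @ x @ [int q])}"
    using word bij_betw_coords by (rule bij_betw_trans)
  fix s t
  assume st: "s \<in> pverts ?G" "t \<in> pverts ?G"
  then have w: "word s \<in> words p q" "word t \<in> words p q"
    using word by (auto dest: bij_betwE)
  have "(s, t) \<in> parcs ?G \<longleftrightarrow> rotation (caterpillar (word s)) (caterpillar (word t))"
    using st unfolding caterpillar_word[OF st(1)] caterpillar_word[OF st(2)]
    by (simp add: color_graph_def)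
  also have "\<dots> \<longleftrightarrow> lattice_adj p (coords 0 (word s)) (coords 0 (word t))"
    using w by (simp only: rotation_caterpillar_iff lattice_adj_coords_iff)
  also have "\<dots> \<longleftrightarrow> ((coords 0 \<circ> word) s, (coords 0 \<circ> word) t) \<in> parcs (lattice_graph p)"
    using w by (simp add: lattice_graph_def length_coords words_def)
  finally show "(s, t) \<in> parcs ?G \<longleftrightarrow>
    ((coords 0 \<circ> word) s, (coords 0 \<circ> word) t) \<in> parcs (lattice_graph p)" .
qed

end
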